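(* There exist instances of the online resource allocation problem in the i.i.d. model with $\gamma = \frac{\epsilon^2}{\log n}$ such that no online algorithm, even one with complete knowledge of the distribution, achieves an approximation factor of $1-o(\epsilon)$.
   Context: Online resource allocation problem: $n$ resources with capacities $c_i>0$; each request $j$ can be served by one option $k$ from a finite set, or dropped; option $k$ for request $j$ consumes $a_{ijk}\geq0$ of resource $i$ and yields type-$i$ profit $w_{ijk}\geq 0$. $m$ requests arrive one by one, drawn i.i.d. from a distribution over request types ($p_j$ the probability of type $j$), and each must be irrevocably served or dropped on arrival; total consumption of resource $i$ may not exceed $c_i$, and the objective is $\min_i$(total type-$i$ profit). $W_{E}$ is the optimal value of the expected-instance LP: maximize $\lambda$ s.t. $\sum_{j,k} m p_j w_{ijk}x_{jk}\geq\lambda$ and $\sum_{j,k} m p_j a_{ijk}x_{jk}\leq c_i$ for all $i$, $\sum_k x_{jk}\leq 1$, $x\geq 0$. $\gamma=\max(\{a_{ijk}/c_i\}\cup\{w_{ijk}/W_{E}\})$. The approximation factor of an algorithm is the ratio of its expected objective value to $W_{E}$. *)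

theory Defs
  imports "HOL-Probability.Probability" "HOL-Library.Landau_Symbols"
begin

record allocation_instance =
  num_resources :: nat
  num_requests :: nat
  types :: "nat set"
  options :: "nat set"
  type_pmf :: "nat pmf"
  capacity :: "nat \<Rightarrow> real"
  consumption :: "nat \<Rightarrow> nat \<Rightarrow> nat \<Rightarrow> real"
  profit :: "nat \<Rightarrow> nat \<Rightarrow> nat \<Rightarrow> real"

text \<open>
  Resources are indexed by \<open>{..<num_resources I}\<close>; \<open>consumption I i j k\<close> and
  \<open>profit I i j k\<close> are the quantities \<open>a\<close> and \<open>w\<close> for resource (profit type) \<open>i\<close>,
  request type \<open>j\<close> and option \<open>k\<close>.
\<close>

definition valid_instance :: "allocation_instance \<Rightarrow> bool" where
  "valid_instance I \<longleftrightarrow>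
     finite (types I) \<and> finite (options I) \<and> set_pmf (type_pmf I) \<subseteq> types I \<and>
     (\<forall>i<num_resources I. capacity I i > 0) \<and>
     (\<forall>i<num_resources I. \<forall>j\<in>types I. \<forall>k\<in>options I.
        consumption I i j k \<ge> 0 \<and> profit I i j k \<ge> 0)"

definition expected_LP_feasible ::
    "allocation_instance \<Rightarrow> (nat \<Rightarrow> nat \<Rightarrow> real) \<Rightarrow> real \<Rightarrow> bool" where
  "expected_LP_feasible I x l \<longleftrightarrow>
     (\<forall>i<num_resources I.
        (\<Sum>j\<in>types I. \<Sum>k\<in>options I.
           real (num_requests I) * pmf (type_pmf I) j * profit I i j k * x j k) \<ge> l) \<and>
     (\<forall>i<num_resources I.
        (\<Sum>j\<in>types I. \<Sum>k\<in>options I.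
           real (num_requests I) * pmf (type_pmf I) j * consumption I i j k * x j k)
          \<le> capacity I i) \<and>
     (\<forall>j\<in>types I. (\<Sum>k\<in>options I. x j k) \<le> 1) \<and>
     (\<forall>j\<in>types I. \<forall>k\<in>options I. x j k \<ge> 0)"

definition W_E :: "allocation_instance \<Rightarrow> real" where
  "W_E I = Sup {l. \<exists>x. expected_LP_feasible I x l}"

definition gamma_param :: "allocation_instance \<Rightarrow> real" where
  "gamma_param I = Max
     ({consumption I i j k / capacity I i | i j k.
         i < num_resources I \<and> j \<in> types I \<and> k \<in> options I} \<union>
      {profit I i j k / W_E I | i j k.
         i < num_resources I \<and> j \<in> types I \<and> k \<in> options I})"

text \<open>
  A history lists the requests seen so far, each with the decision taken for it:
  \<open>None\<close> drops the request, \<open>Some k\<close> serves it with option \<open>k\<close>. A (possibly randomized)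
  policy maps the history and the type of the current request to a distribution over
  decisions; in particular it may depend on the number of requests already seen.
\<close>

type_synonym history = "(nat \<times> nat option) list"
type_synonym policy = "history \<Rightarrow> nat \<Rightarrow> nat option pmf"

primrec run :: "allocation_instance \<Rightarrow> policy \<Rightarrow> nat \<Rightarrow> history pmf" where
  "run I A 0 = return_pmf []"
| "run I A (Suc t) =
     bind_pmf (run I A t) (\<lambda>h.
       bind_pmf (type_pmf I) (\<lambda>j.
         map_pmf (\<lambda>d. h @ [(j, d)]) (A h j)))"

definition total :: "(nat \<Rightarrow> nat \<Rightarrow> real) \<Rightarrow> history \<Rightarrow> real" where
  "total q h = (\<Sum>(j, d)\<leftarrow>h. case d of None \<Rightarrow> 0 | Some k \<Rightarrow> q j k)"

text \<open>
  An online algorithm uses only the available options and respects the capacities on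
  every outcome of positive probability.
\<close>

definition online_algorithm :: "allocation_instance \<Rightarrow> policy \<Rightarrow> bool" where
  "online_algorithm I A \<longleftrightarrow>
     (\<forall>h\<in>set_pmf (run I A (num_requests I)).
        (\<forall>(j, d)\<in>set h. d \<in> insert None (Some ` options I)) \<and>
        (\<forall>i<num_resources I. total (consumption I i) h \<le> capacity I i))"

definition objective :: "allocation_instance \<Rightarrow> history \<Rightarrow> real" where
  "objective I h = (MIN i\<in>{..<num_resources I}. total (profit I i) h)"

definition approx_factor :: "allocation_instance \<Rightarrow> policy \<Rightarrow> real" where
  "approx_factor I A =
     measure_pmf.expectation (run I A (num_requests I)) (objective I) / W_E I"

end

theory Submission
  imports Defs
begin

text \<open>
  Every request carries an independent uniform sign for each profit type and yields profit
  \<open>(1 \<plusminus> \<delta>) / m\<close> of that type; nothing is consumed, so serving everything is optimal and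
  \<open>W\<^sub>E = 1\<close>. The type-\<open>i\<close> profit is then \<open>1 + \<delta> S\<^sub>i / m\<close> for independent simple random walks
  \<open>S\<^sub>i\<close> of length \<open>m\<close>, about \<open>2 ln n / \<epsilon>\<^sup>2\<close>. Cut a walk into about \<open>ln n\<close> blocks: in each block it
  drops by the order of the standard deviation with constant probability, so with probability of
  order \<open>1 / n\<close> the whole walk ends at most at \<open>- c \<epsilon> m\<close>. Hence with constant probability one of
  the walks \<open>S\<^sub>1, \<dots>, S\<^sub>n\<^sub>-\<^sub>1\<close> does so, while the independent \<open>S\<^sub>0\<close> keeps mean zero on the
  complement; the expected minimum loses the order of \<open>\<epsilon>\<close>.
\<close>

section \<open>Lower tails of the simple random walk\<close>

definition rademacher :: "int pmf" where
  "rademacher = pmf_of_set {-1, 1}"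

primrec walk :: "nat \<Rightarrow> int pmf" where
  "walk 0 = return_pmf 0"
| "walk (Suc t) = bind_pmf (walk t) (\<lambda>x. map_pmf (\<lambda>y. x + y) rademacher)"

lemma set_pmf_rademacher: "set_pmf rademacher = {-1, 1}"
  by (simp add: rademacher_def set_pmf_of_set)

lemma expectation_rademacher:
  fixes f :: "int \<Rightarrow> real"
  shows "measure_pmf.expectation rademacher f = (f (-1) + f 1) / 2"
  by (simp add: rademacher_def integral_pmf_of_set)

lemma map_uminus_rademacher: "map_pmf uminus rademacher = rademacher"
  unfolding rademacher_def by (subst map_pmf_of_set_inj) (auto simp: insert_commute)

lemma set_pmf_walk: "set_pmf (walk t) \<subseteq> {- int t..int t}"
proof (induction t)
  case (Suc t)
  then show ?case by (fastforce simp: set_pmf_rademacher)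
qed simp

lemma finite_set_pmf_walk [simp]: "finite (set_pmf (walk t))"
  by (rule finite_subset[OF set_pmf_walk]) simp

lemma integrable_walk [simp]:
  fixes f :: "int \<Rightarrow> real"
  shows "integrable (measure_pmf (walk t)) f"
  by (rule integrable_measure_pmf_finite) simp

text \<open>Conditioning on the last step turns each moment into a recursion in \<open>t\<close>;
  finite support makes the expectation a finite sum.\<close>

lemma expectation_walk_Suc:
  fixes f :: "int \<Rightarrow> real"
  shows "measure_pmf.expectation (walk (Suc t)) f =
    measure_pmf.expectation (walk t) (\<lambda>x. (f (x - 1) + f (x + 1)) / 2)"
proof -
  have "measure_pmf.expectation (walk (Suc t)) f =
     (\<Sum>a\<in>set_pmf (walk t). pmf (walk t) a *\<^sub>R
        measure_pmf.expectation (map_pmf (\<lambda>y. a + y) rademacher) f)"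
    unfolding walk.simps
    by (rule pmf_expectation_bind) (auto simp: set_pmf_rademacher)
  also have "\<dots> = (\<Sum>a\<in>set_pmf (walk t). (f (a - 1) + f (a + 1)) / 2 * pmf (walk t) a)"
    by (simp add: expectation_rademacher mult.commute)
  also have "\<dots> = measure_pmf.expectation (walk t) (\<lambda>x. (f (x - 1) + f (x + 1)) / 2)"
    by (rule integral_measure_pmf_real[symmetric]) auto
  finally show ?thesis .
qed

lemma walk_moment_1: "measure_pmf.expectation (walk t) real_of_int = 0"
  by (induction t) (simp_all add: expectation_walk_Suc del: walk.simps(2))

lemma walk_moment_2: "measure_pmf.expectation (walk t) (\<lambda>x. real_of_int x ^ 2) = real t"
proof (induction t)
  case (Suc t)
  have "measure_pmf.expectation (walk (Suc t)) (\<lambda>x. real_of_int x ^ 2) =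
      measure_pmf.expectation (walk t) (\<lambda>x. real_of_int x ^ 2 + 1)"
    unfolding expectation_walk_Suc
    by (rule Bochner_Integration.integral_cong) (auto simp: field_simps power2_eq_square)
  with Suc show ?case by simp
qed simp

text \<open>Averaging the fourth powers of \<open>x - 1\<close> and \<open>x + 1\<close> adds
  \<open>6 * x ^ 2 + 1\<close>, so by the second moment the increment is
  \<open>6 * t + 1\<close>.\<close>

lemma walk_moment_4:
  "measure_pmf.expectation (walk t) (\<lambda>x. real_of_int x ^ 4) = 3 * real t ^ 2 - 2 * real t"
proof (induction t)
  case (Suc t)
  have "measure_pmf.expectation (walk (Suc t)) (\<lambda>x. real_of_int x ^ 4) =
      measure_pmf.expectation (walk t) (\<lambda>x. real_of_int x ^ 4 + 6 * real_of_int x ^ 2 + 1)"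
    unfolding expectation_walk_Suc
    by (rule Bochner_Integration.integral_cong)
      (auto simp: field_simps power2_eq_square power4_eq_xxxx)
  also have "\<dots> = 3 * real t ^ 2 - 2 * real t + 6 * real t + 1"
    by (simp add: Suc walk_moment_2)
  finally show ?case by (simp add: field_simps power2_eq_square)
qed simp

lemma map_uminus_walk: "map_pmf uminus (walk t) = walk t"
proof (induction t)
  case (Suc t)
  have "map_pmf uminus (walk (Suc t)) =
      bind_pmf (map_pmf uminus (walk t)) (\<lambda>x. map_pmf (\<lambda>y. x + y) (map_pmf uminus rademacher))"
    by (simp add: map_bind_pmf bind_map_pmf pmf.map_comp o_def)
  then show ?case by (simp add: Suc map_uminus_rademacher)
qed simp

lemma walk_add: "walk (a + b) = map_pmf (\<lambda>(x, y). x + y) (pair_pmf (walk a) (walk b))"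
proof (induction b)
  case (Suc b)
  then show ?case
    by (simp add: map_pmf_def pair_pmf_def bind_assoc_pmf bind_return_pmf add.assoc)
qed (simp add: pair_pmf_def bind_return_pmf' map_pmf_def bind_assoc_pmf bind_return_pmf)

section \<open>Anti-concentration of a single walk\<close>

definition lower_tail :: "nat \<Rightarrow> real \<Rightarrow> real" where
  "lower_tail t s = measure_pmf.prob (walk t) {x. real_of_int x \<le> - s}"

lemma lower_tail_eq_upper_tail:
  "lower_tail t s = measure_pmf.prob (walk t) {x. real_of_int x \<ge> s}"
proof -
  have "lower_tail t s = measure_pmf.prob (map_pmf uminus (walk t)) {x. real_of_int x \<le> - s}"
    by (simp add: lower_tail_def map_uminus_walk)
  also have "\<dots> = measure_pmf.prob (walk t) {x. real_of_int x \<ge> s}"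
    unfolding measure_map_pmf by (rule arg_cong[where f = "measure_pmf.prob (walk t)"]) auto
  finally show ?thesis .
qed

text \<open>If two consecutive blocks, which are independent, fall by \<open>s\<close> and by
  \<open>u\<close>, the whole walk falls by \<open>s + u\<close>.\<close>

lemma lower_tail_add: "lower_tail a s * lower_tail b u \<le> lower_tail (a + b) (s + u)"
proof -
  let ?A = "{x. real_of_int x \<le> - s}" and ?B = "{x. real_of_int x \<le> - u}"
  have "lower_tail a s * lower_tail b u =
      measure_pmf.prob (pair_pmf (walk a) (walk b)) (?A \<times> ?B)"
    unfolding lower_tail_def by (rule measure_pmf_prob_product[symmetric]) auto
  also have "\<dots> \<le> measure_pmf.prob (pair_pmf (walk a) (walk b))
      ((\<lambda>(x, y). x + y) -` {x. real_of_int x \<le> - (s + u)})"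
    by (rule measure_pmf.finite_measure_mono) auto
  finally show ?thesis by (simp add: lower_tail_def walk_add)
qed

lemma lower_tail_0_ge_half: "lower_tail t 0 \<ge> 1 / 2"
proof -
  have "1 = measure_pmf.prob (walk t) ({x. real_of_int x \<le> - 0} \<union> {x. real_of_int x \<ge> 0})"
  proof -
    have "{x. real_of_int x \<le> - 0} \<union> {x. real_of_int x \<ge> 0} = UNIV" by auto
    then show ?thesis by (simp only: measure_pmf_UNIV)
  qed
  also have "\<dots> \<le> measure_pmf.prob (walk t) {x. real_of_int x \<le> - 0} +
      measure_pmf.prob (walk t) {x. real_of_int x \<ge> 0}"
    by (rule measure_Un_le) auto
  also have "\<dots> = lower_tail t 0 + lower_tail t 0"
    using lower_tail_eq_upper_tail[of t 0] by (simp add: lower_tail_def)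
  finally show ?thesis by simp
qed

text \<open>
  The polynomial \<open>(x\<^sup>2 - t / 4) (8 t - x\<^sup>2)\<close> is at most \<open>16 t\<^sup>2\<close>, is negative for \<open>x\<^sup>2 < t / 4\<close>, and
  has mean at least \<open>13 / 4 t\<^sup>2\<close> by the second and fourth moments.
\<close>

lemma lower_tail_sqrt_ge:
  assumes "t > 0"
  shows "lower_tail t (sqrt t / 2) \<ge> 1 / 10"
proof -
  let ?r = "real t" and ?M = "walk t"
  let ?q = "\<lambda>x :: int. (real_of_int x ^ 2 - ?r / 4) * (8 * ?r - real_of_int x ^ 2)"
  let ?U = "{x. real_of_int x \<le> - (sqrt t / 2)}" and ?V = "{x. real_of_int x \<ge> sqrt t / 2}"
  have q_le: "?q x \<le> 16 * ?r ^ 2 * (indicator ?U x + indicator ?V x)" for x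
  proof (cases "x \<in> ?U \<union> ?V")
    case True
    \<comment> \<open>Completing the square: \<open>33 / 8\<close> and \<open>31 / 8\<close> are the
      midpoint and the half-distance of the roots \<open>1 / 4\<close> and \<open>8\<close>, and the
      square of \<open>31 / 8\<close> is below 16.\<close>
    have "?q x = (31 / 8 * ?r) ^ 2 - (real_of_int x ^ 2 - 33 / 8 * ?r) ^ 2"
      by (simp add: algebra_simps power2_eq_square)
    also have "\<dots> \<le> 16 * ?r ^ 2"
      by (rule order_trans[of _ "(31 / 8 * ?r) ^ 2"]) (simp_all add: power_mult_distrib power_divide)
    also have "\<dots> \<le> 16 * ?r ^ 2 * (indicator ?U x + indicator ?V x)"
      using True by (auto simp: indicator_def)
    finally show ?thesis .
  next
    case False
    then have "\<bar>real_of_int x\<bar> < sqrt t / 2" by auto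
    then have "\<bar>real_of_int x\<bar> ^ 2 < (sqrt t / 2) ^ 2"
      by (intro power_strict_mono) auto
    then have x2: "real_of_int x ^ 2 < ?r / 4"
      by (simp add: power_divide)
    then have "real_of_int x ^ 2 \<le> 8 * ?r"
      by (rule order_trans[OF less_imp_le]) simp
    then have "?q x \<le> 0"
      using x2 by (intro mult_nonpos_nonneg) auto
    then show ?thesis using False by auto
  qed
  have "measure_pmf.expectation ?M ?q =
     measure_pmf.expectation ?M (\<lambda>x. 33 / 4 * ?r * real_of_int x ^ 2 - real_of_int x ^ 4 - 2 * ?r ^ 2)"
    by (rule Bochner_Integration.integral_cong)
      (auto simp: algebra_simps power2_eq_square power4_eq_xxxx)
  also have "\<dots> = 33 / 4 * ?r * ?r - (3 * ?r ^ 2 - 2 * ?r) - 2 * ?r ^ 2"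
    by (simp add: walk_moment_2 walk_moment_4)
  finally have "13 / 4 * ?r ^ 2 \<le> measure_pmf.expectation ?M ?q"
    by (simp add: power2_eq_square algebra_simps)
  also have "\<dots> \<le> measure_pmf.expectation ?M (\<lambda>x. 16 * ?r ^ 2 * (indicator ?U x + indicator ?V x))"
    by (intro integral_mono q_le) auto
  also have "\<dots> = 16 * ?r ^ 2 * (measure_pmf.prob ?M ?U + measure_pmf.prob ?M ?V)"
    by simp
  also have "\<dots> = 16 * ?r ^ 2 * (2 * lower_tail t (sqrt t / 2))"
    using lower_tail_eq_upper_tail[of t "sqrt t / 2"] by (simp add: lower_tail_def)
  finally have "13 / 4 * ?r ^ 2 \<le> (32 * lower_tail t (sqrt t / 2)) * ?r ^ 2"
    by (simp add: algebra_simps)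
  \<comment> \<open>The quotient 13/128 is just above 1/10.\<close>
  then have "13 / 4 \<le> 32 * lower_tail t (sqrt t / 2)"
    using assms by (subst (asm) mult_le_cancel_right) auto
  then show ?thesis by simp
qed

text \<open>Each of the \<open>L\<close> blocks of length \<open>b\<close> falls by
  \<open>sqrt b / 2\<close> with probability at least 1/10. The remainder of length \<open>r\<close>
  only has to end at or below 0, which costs the factor 1/2.\<close>

lemma lower_tail_blocks:
  assumes "b > 0"
  shows "lower_tail (L * b + r) (real L * (sqrt b / 2)) \<ge> (1 / 10) ^ L / 2"
proof (induction L)
  case 0
  show ?case using lower_tail_0_ge_half by simp
next
  case (Suc L)
  have "(1 / 10) ^ Suc L / 2 = 1 / 10 * ((1 / 10) ^ L / 2 :: real)" by simp
  also have "\<dots> \<le> lower_tail b (sqrt b / 2) * lower_tail (L * b + r) (real L * (sqrt b / 2))"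
    using lower_tail_sqrt_ge[OF assms] Suc by (intro mult_mono) auto
  also have "\<dots> \<le> lower_tail (b + (L * b + r)) (sqrt b / 2 + real L * (sqrt b / 2))"
    by (rule lower_tail_add)
  also have "\<dots> = lower_tail (Suc L * b + r) (real (Suc L) * (sqrt b / 2))"
    by (simp add: algebra_simps add_divide_distrib)
  finally show ?case .
qed

section \<open>Expected minimum of independent walks\<close>

text \<open>Let \<open>Q\<close> indicate that none of the walks 1 to \<open>n - 1\<close> ends at
  or below \<open>- s\<close>. The minimum is at most \<open>- s\<close> if \<open>Q = 0\<close> and
  at most \<open>y 0\<close> if \<open>Q = 1\<close>, hence at most
  \<open>- s + (y 0 + s) * Q\<close>. Walk 0 has mean zero and is independent of \<open>Q\<close>,
  so this bound has mean \<open>- s * (1 - q)\<close> with \<open>q\<close> the mean of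
  \<open>Q\<close>.\<close>

lemma expectation_Min_walks_le:
  fixes s :: real
  assumes n: "n > 0"
  shows "measure_pmf.expectation (Pi_pmf {..<n} 0 (\<lambda>_. walk m))
           (\<lambda>y. MIN i\<in>{..<n}. real_of_int (y i))
         \<le> - s * (1 - (1 - lower_tail m s) ^ (n - 1))"
proof -
  let ?P = "Pi_pmf {..<n} 0 (\<lambda>_. walk m)"
  define ind :: "int \<Rightarrow> real" where "ind = indicator {x. real_of_int x > - s}"
  \<comment> \<open>The shift by \<open>m\<close> makes the factor of walk 0 nonnegative on its
    support, as the product rule under \<open>Pi_pmf\<close> is applied to nonnegative factors; the
    product over \<open>g\<close> later removes the shift.\<close>
  define f where "f = (\<lambda>i v. if i = (0::nat) then real_of_int v + real m else ind v)"
  define g where "g = (\<lambda>i v. if i = (0::nat) then 1 else ind v)"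
  define q where "q = (1 - lower_tail m s) ^ (n - 1)"
  have split: "(\<Prod>i<n. h i) = h 0 * (\<Prod>i\<in>{1..<n}. h i)" for h :: "nat \<Rightarrow> real"
    using n by (simp add: prod.atLeast_Suc_lessThan lessThan_atLeast0)
  have fin: "finite (set_pmf ?P)"
    by (auto simp: set_Pi_pmf)
  have Eind: "measure_pmf.expectation (walk m) ind = 1 - lower_tail m s"
  proof -
    have "measure_pmf.expectation (walk m) ind = measure_pmf.prob (walk m) {x. real_of_int x > - s}"
      by (simp add: ind_def)
    also have "{x. real_of_int x > - s} = - {x. real_of_int x \<le> - s}" by auto
    also have "measure_pmf.prob (walk m) \<dots> = 1 - lower_tail m s"
      using measure_pmf.prob_compl[of "{x. real_of_int x \<le> - s}" "walk m"]
      by (simp add: lower_tail_def Compl_eq_Diff_UNIV)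
    finally show ?thesis .
  qed
  have Eg: "measure_pmf.expectation ?P (\<lambda>y. \<Prod>i<n. g i (y i)) = q"
    by (subst expectation_prod_Pi_pmf)
      (auto simp: g_def ind_def[symmetric] Eind q_def split, simp add: ind_def)
  have Ef: "measure_pmf.expectation ?P (\<lambda>y. \<Prod>i<n. f i (y i)) = real m * q"
  proof (subst expectation_prod_Pi_pmf)
    show "0 \<le> f i v" if "v \<in> set_pmf (walk m)" for i v
      using set_pmf_walk[of m] that by (auto simp: f_def ind_def)
    show "(\<Prod>i<n. measure_pmf.expectation (walk m) (f i)) = real m * q"
      by (simp add: split f_def walk_moment_1 Eind q_def)
  qed auto
  have "measure_pmf.expectation ?P (\<lambda>y. MIN i\<in>{..<n}. real_of_int (y i))
      \<le> measure_pmf.expectation ?P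
          (\<lambda>y. - s + ((\<Prod>i<n. f i (y i)) + (s - real m) * (\<Prod>i<n. g i (y i))))"
  proof (rule integral_mono)
    fix y :: "nat \<Rightarrow> int"
    let ?m = "MIN i\<in>{..<n}. real_of_int (y i)"
    have le: "?m \<le> real_of_int (y i)" if "i < n" for i
      using that by (intro Min_le) auto
    define Q where "Q = (\<Prod>i\<in>{1..<n}. ind (y i))"
    have rhs: "- s + ((\<Prod>i<n. f i (y i)) + (s - real m) * (\<Prod>i<n. g i (y i)))
        = - s + (real_of_int (y 0) + s) * Q"
      unfolding split by (simp add: f_def g_def Q_def algebra_simps)
    have "?m \<le> - s + (real_of_int (y 0) + s) * Q"
    proof (cases "\<exists>i\<in>{1..<n}. real_of_int (y i) \<le> - s")
      case True
      then obtain i where i: "i \<in> {1..<n}" "real_of_int (y i) \<le> - s" by blast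
      then have "Q = 0"
        unfolding Q_def by (intro prod_zero) (auto simp: ind_def indicator_def intro!: bexI[of _ i])
      moreover have "?m \<le> - s" using le[of i] i by (intro order_trans[OF le[of i]]) auto
      ultimately show ?thesis by simp
    next
      case False
      then have "Q = 1"
        unfolding Q_def by (intro prod.neutral) (auto simp: ind_def indicator_def)
      then show ?thesis using le[OF n] by simp
    qed
    then show "?m \<le> - s + ((\<Prod>i<n. f i (y i)) + (s - real m) * (\<Prod>i<n. g i (y i)))"
      unfolding rhs .
  qed (intro integrable_measure_pmf_finite fin)+
  also have "\<dots> = - s + (real m * q + (s - real m) * q)"
    by (simp add: integrable_measure_pmf_finite fin Eg Ef)
  also have "\<dots> = - s * (1 - q)"
    by (simp add: algebra_simps)
  finally show ?thesis by (simp add: q_def)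
qed

section \<open>Instances with random signs\<close>

text \<open>The value 0 outside \<open>{..<n}\<close> is the default of \<open>Pi_pmf\<close>, so
  this finite set is exactly the support of \<open>n\<close> independent signs.\<close>

definition sign_vectors :: "nat \<Rightarrow> (nat \<Rightarrow> int) set" where
  "sign_vectors n = PiE_dflt {..<n} 0 (\<lambda>_. {-1, 1})"

definition signs :: "nat \<Rightarrow> nat \<Rightarrow> nat \<Rightarrow> int" where
  "signs n j = from_nat_into (sign_vectors n) j"

text \<open>The request type \<open>j\<close> is a number encoding the sign vector \<open>signs n j\<close>.\<close>

definition sign_instance :: "nat \<Rightarrow> nat \<Rightarrow> real \<Rightarrow> allocation_instance" where
  "sign_instance n m \<delta> =
     \<lparr>num_resources = n, num_requests = m,
      types = to_nat_on (sign_vectors n) ` sign_vectors n, options = {0},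
      type_pmf = map_pmf (to_nat_on (sign_vectors n)) (Pi_pmf {..<n} 0 (\<lambda>_. rademacher)),
      capacity = (\<lambda>_. 1), consumption = (\<lambda>_ _ _. 0),
      profit = (\<lambda>i j k. (1 + \<delta> * real_of_int (signs n j i)) / real m)\<rparr>"

lemma sign_instance_simps [simp]:
  "num_resources (sign_instance n m \<delta>) = n"
  "num_requests (sign_instance n m \<delta>) = m"
  "options (sign_instance n m \<delta>) = {0}"
  "capacity (sign_instance n m \<delta>) i = 1"
  "consumption (sign_instance n m \<delta>) i j k = 0"
  "profit (sign_instance n m \<delta>) i j k = (1 + \<delta> * real_of_int (signs n j i)) / real m"
  by (simp_all add: sign_instance_def)

lemma finite_sign_vectors: "finite (sign_vectors n)"
  unfolding sign_vectors_def by auto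

lemma finite_types_sign_instance: "finite (types (sign_instance n m \<delta>))"
  by (simp add: sign_instance_def finite_sign_vectors)

lemma set_pmf_sign_vectors: "set_pmf (Pi_pmf {..<n} 0 (\<lambda>_. rademacher)) = sign_vectors n"
  by (simp add: set_Pi_pmf sign_vectors_def o_def set_pmf_rademacher)

lemma signs_to_nat_on: "y \<in> sign_vectors n \<Longrightarrow> signs n (to_nat_on (sign_vectors n) y) = y"
  by (simp add: signs_def countable_finite finite_sign_vectors)

lemma signs_image_types: "signs n ` types (sign_instance n m \<delta>) = sign_vectors n"
  by (auto simp: sign_instance_def image_image signs_to_nat_on intro!: image_eqI)

lemma signs_types:
  "j \<in> types (sign_instance n m \<delta>) \<Longrightarrow> i < n \<Longrightarrow> signs n j i \<in> {-1, 1}"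
  using signs_image_types[of n m \<delta>] by (auto simp: sign_vectors_def PiE_dflt_def)

lemma set_pmf_type_pmf: "set_pmf (type_pmf (sign_instance n m \<delta>)) = types (sign_instance n m \<delta>)"
  by (simp add: sign_instance_def set_pmf_sign_vectors)

lemma map_signs_type_pmf:
  "map_pmf (signs n) (type_pmf (sign_instance n m \<delta>)) = Pi_pmf {..<n} 0 (\<lambda>_. rademacher)"
proof -
  have "map_pmf (signs n) (type_pmf (sign_instance n m \<delta>)) =
      map_pmf (\<lambda>y. y) (Pi_pmf {..<n} 0 (\<lambda>_. rademacher))"
    unfolding sign_instance_def allocation_instance.select_convs pmf.map_comp
    by (intro map_pmf_cong refl) (simp add: set_pmf_sign_vectors signs_to_nat_on)
  then show ?thesis by simp
qed

lemma profit_sign_instance_nonneg: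
  assumes "0 \<le> \<delta>" "\<delta> \<le> 1" "j \<in> types (sign_instance n m \<delta>)" "i < n"
  shows "0 \<le> profit (sign_instance n m \<delta>) i j k"
  using signs_types[OF assms(3,4)] assms by auto

lemma valid_sign_instance:
  assumes "0 \<le> \<delta>" "\<delta> \<le> 1"
  shows "valid_instance (sign_instance n m \<delta>)"
  using profit_sign_instance_nonneg[OF assms] unfolding valid_instance_def
  by (auto simp: finite_types_sign_instance set_pmf_type_pmf simp del: sign_instance_simps(6))

section \<open>The expected LP and \<gamma> of a sign instance\<close>

lemma expected_profit_sign_instance:
  assumes "i < n" "m > 0"
  shows "(\<Sum>j\<in>types (sign_instance n m \<delta>). real m * pmf (type_pmf (sign_instance n m \<delta>)) j *
           profit (sign_instance n m \<delta>) i j k) = 1"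
proof -
  let ?I = "sign_instance n m \<delta>"
  have "(\<Sum>j\<in>types ?I. real m * pmf (type_pmf ?I) j * profit ?I i j k) =
      (\<Sum>j\<in>types ?I. (1 + \<delta> * real_of_int (signs n j i)) * pmf (type_pmf ?I) j)"
    using assms by (intro sum.cong) auto
  also have "\<dots> = measure_pmf.expectation (type_pmf ?I) (\<lambda>j. 1 + \<delta> * real_of_int (signs n j i))"
    by (rule integral_measure_pmf_real[symmetric])
      (auto simp: finite_types_sign_instance set_pmf_type_pmf)
  also have "\<dots> = measure_pmf.expectation
      (map_pmf (\<lambda>y. y i) (map_pmf (signs n) (type_pmf ?I))) (\<lambda>v. 1 + \<delta> * real_of_int v)"
    by simp
  also have "map_pmf (\<lambda>y. y i) (map_pmf (signs n) (type_pmf ?I)) = rademacher"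
    using assms by (simp add: map_signs_type_pmf Pi_pmf_component)
  also have "measure_pmf.expectation rademacher (\<lambda>v. 1 + \<delta> * real_of_int v) = 1"
    by (simp add: expectation_rademacher)
  finally show ?thesis .
qed

text \<open>Since \<open>x j 0 \<le> 1\<close>, the constraint of resource 0 alone bounds the value
  by 1. Serving everything attains 1, because nothing is consumed and the signs average out.\<close>

lemma W_E_sign_instance:
  assumes "n > 0" "m > 0" "0 \<le> \<delta>" "\<delta> \<le> 1"
  shows "W_E (sign_instance n m \<delta>) = 1"
proof -
  let ?I = "sign_instance n m \<delta>"
  have "l \<le> 1" if "expected_LP_feasible ?I x l" for x l
  proof -
    from that assms(1) have
      l: "l \<le> (\<Sum>j\<in>types ?I. real m * pmf (type_pmf ?I) j * profit ?I 0 j 0 * x j 0)"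
      and x: "\<And>j. j \<in> types ?I \<Longrightarrow> x j 0 \<le> 1"
      unfolding expected_LP_feasible_def by (auto simp del: sign_instance_simps(6))
    have "l \<le> (\<Sum>j\<in>types ?I. real m * pmf (type_pmf ?I) j * profit ?I 0 j 0 * x j 0)"
      by (rule l)
    also have "\<dots> \<le> (\<Sum>j\<in>types ?I. real m * pmf (type_pmf ?I) j * profit ?I 0 j 0)"
      using x profit_sign_instance_nonneg[OF assms(3,4) _ assms(1)]
      by (intro sum_mono mult_left_le mult_nonneg_nonneg) auto
    also have "\<dots> = 1"
      using assms by (intro expected_profit_sign_instance)
    finally show ?thesis .
  qed
  moreover have "expected_LP_feasible ?I (\<lambda>_ _. 1) 1"
    using assms expected_profit_sign_instance[of _ n m \<delta> 0] unfolding expected_LP_feasible_def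
    by (auto simp del: sign_instance_simps(6))
  ultimately show ?thesis
    unfolding W_E_def by (intro cSup_eq_maximum) auto
qed

lemma gamma_param_sign_instance:
  assumes "n > 0" "m > 0" "0 \<le> \<delta>" "\<delta> \<le> 1"
  shows "gamma_param (sign_instance n m \<delta>) = (1 + \<delta>) / real m"
proof -
  let ?I = "sign_instance n m \<delta>"
  let ?C = "{consumption ?I i j k / capacity ?I i | i j k.
               i < num_resources ?I \<and> j \<in> types ?I \<and> k \<in> options ?I}"
  let ?W = "{profit ?I i j k / W_E ?I | i j k.
               i < num_resources ?I \<and> j \<in> types ?I \<and> k \<in> options ?I}"
  have C: "?C \<subseteq> {0}" by auto
  have W: "?W \<subseteq> {(1 - \<delta>) / real m, (1 + \<delta>) / real m}"
    using signs_types[of _ n m \<delta>] by (fastforce simp: W_E_sign_instance assms)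
  \<comment> \<open>The type with all signs positive attains the larger profit ratio.\<close>
  have "(\<lambda>i. if i < n then 1 else 0) \<in> signs n ` types ?I"
    unfolding signs_image_types by (auto simp: sign_vectors_def PiE_dflt_def)
  then obtain j where j: "j \<in> types ?I" "signs n j = (\<lambda>i. if i < n then 1 else 0)"
    by auto
  have "(1 + \<delta>) / real m \<in> ?W"
    using j assms unfolding mem_Collect_eq
    by (intro exI[of _ 0] exI[of _ j] exI[of _ "0 :: nat"]) (simp add: W_E_sign_instance)
  moreover have "finite (?C \<union> ?W)"
    using finite_subset[OF C] finite_subset[OF W] by auto
  moreover have "y \<le> (1 + \<delta>) / real m" if "y \<in> ?C \<union> ?W" for y
  proof -
    have "y \<in> {0, (1 - \<delta>) / real m, (1 + \<delta>) / real m}" using that C W by blast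
    then show ?thesis using assms by (auto intro!: divide_right_mono)
  qed
  ultimately show ?thesis
    unfolding gamma_param_def by (intro Max_eqI) auto
qed

section \<open>From runs of a policy to independent walks\<close>

text \<open>The decisions are ignored on purpose: this is the fluctuation that would result from
  serving every request.\<close>

definition sign_sum :: "nat \<Rightarrow> history \<Rightarrow> nat \<Rightarrow> int" where
  "sign_sum n h i = (\<Sum>(j, d)\<leftarrow>h. signs n j i)"

text \<open>Decisions do not influence which types arrive, so for every policy the coordinates
  perform independent walks.\<close>

lemma map_sign_sum_run:
  "map_pmf (sign_sum n) (run (sign_instance n m \<delta>) A t) = Pi_pmf {..<n} 0 (\<lambda>_. walk t)"
proof (induction t)
  case 0
  show ?case by (auto simp: sign_sum_def fun_eq_iff)
next
  case (Suc t)
  let ?I = "sign_instance n m \<delta>" and ?R = "Pi_pmf {..<n} 0 (\<lambda>_. rademacher)"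
  have step: "sign_sum n (h @ [(j, d)]) = (\<lambda>i. sign_sum n h i + signs n j i)" for h j d
    by (simp add: sign_sum_def fun_eq_iff)
  have "map_pmf (sign_sum n) (run ?I A (Suc t)) =
      bind_pmf (run ?I A t) (\<lambda>h. bind_pmf (type_pmf ?I)
        (\<lambda>j. map_pmf (\<lambda>_. (\<lambda>i. sign_sum n h i + signs n j i)) (A h j)))"
    by (simp add: map_bind_pmf pmf.map_comp o_def step)
  also have "\<dots> = bind_pmf (map_pmf (sign_sum n) (run ?I A t))
      (\<lambda>y. map_pmf (\<lambda>z i. y i + z i) (map_pmf (signs n) (type_pmf ?I)))"
    by (simp add: bind_map_pmf pmf.map_comp o_def) (simp add: map_pmf_def)
  also have "\<dots> = bind_pmf (Pi_pmf {..<n} 0 (\<lambda>_. walk t)) (\<lambda>y. map_pmf (\<lambda>z i. y i + z i) ?R)"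
    unfolding Suc map_signs_type_pmf ..
  also have "\<dots> = bind_pmf (Pi_pmf {..<n} 0 (\<lambda>_. walk t))
      (\<lambda>y. Pi_pmf {..<n} 0 (\<lambda>i. map_pmf (\<lambda>v. y i + v) rademacher))"
  proof (intro bind_pmf_cong refl)
    fix y assume "y \<in> set_pmf (Pi_pmf {..<n} 0 (\<lambda>_. walk t))"
    \<comment> \<open>Outside \<open>{..<n}\<close> the sum \<open>y i + z i\<close> must equal the
      default 0 of \<open>Pi_pmf\<close>.\<close>
    then have y: "y i = 0" if "i \<ge> n" for i
      using that by (auto simp: set_Pi_pmf PiE_dflt_def)
    have "Pi_pmf {..<n} 0 (\<lambda>i. map_pmf (\<lambda>v. y i + v) rademacher) =
        bind_pmf ?R (\<lambda>z. Pi_pmf {..<n} 0 (\<lambda>i. return_pmf (y i + z i)))"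
      unfolding map_pmf_def by (rule Pi_pmf_bind) simp
    also have "\<dots> = map_pmf (\<lambda>z i. y i + z i) ?R"
      unfolding map_pmf_def
      by (intro bind_pmf_cong refl)
        (auto simp: set_pmf_sign_vectors sign_vectors_def PiE_dflt_def fun_eq_iff y)
    finally show "map_pmf (\<lambda>z i. y i + z i) ?R =
        Pi_pmf {..<n} 0 (\<lambda>i. map_pmf (\<lambda>v. y i + v) rademacher)" ..
  qed
  also have "\<dots> = Pi_pmf {..<n} 0 (\<lambda>_. walk (Suc t))"
    unfolding walk.simps by (rule Pi_pmf_bind[symmetric]) simp
  finally show ?case .
qed

lemma set_pmf_run:
  "h \<in> set_pmf (run I A t) \<Longrightarrow> length h = t \<and> fst ` set h \<subseteq> set_pmf (type_pmf I)"
proof (induction t arbitrary: h)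
  case (Suc t)
  then obtain h' j d where "h = h' @ [(j, d)]" "h' \<in> set_pmf (run I A t)"
    "j \<in> set_pmf (type_pmf I)"
    by auto
  with Suc.IH show ?case by simp
qed simp

text \<open>Finitely many types and options leave finitely many histories of the given length, so
  every function of the run is integrable.\<close>

lemma finite_set_pmf_run:
  assumes "valid_instance I" "online_algorithm I A"
  shows "finite (set_pmf (run I A (num_requests I)))"
proof (rule finite_subset)
  let ?S = "types I \<times> insert None (Some ` options I)"
  show "set_pmf (run I A (num_requests I)) \<subseteq> {h. set h \<subseteq> ?S \<and> length h = num_requests I}"
  proof (intro subsetI CollectI conjI)
    fix h assume h: "h \<in> set_pmf (run I A (num_requests I))"
    show "length h = num_requests I" using set_pmf_run[OF h] ..
    fix a assume a: "a \<in> set h"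
    then have "fst a \<in> types I"
      using set_pmf_run[OF h] assms(1) unfolding valid_instance_def by blast
    moreover have "snd a \<in> insert None (Some ` options I)"
      using assms(2) h a unfolding online_algorithm_def case_prod_beta by blast
    ultimately show "a \<in> ?S" by (cases a) auto
  qed
  show "finite {h. set h \<subseteq> ?S \<and> length h = num_requests I}"
    using assms(1) by (intro finite_lists_length_eq) (auto simp: valid_instance_def)
qed

text \<open>Dropping a request only forgoes a nonnegative profit, so serving all of \<open>h\<close>
  dominates.\<close>

lemma total_profit_sign_instance_le:
  assumes "0 \<le> \<delta>" "\<delta> \<le> 1" "i < n" "fst ` set h \<subseteq> types (sign_instance n m \<delta>)"
  shows "total (profit (sign_instance n m \<delta>) i) h
           \<le> (real (length h) + \<delta> * real_of_int (sign_sum n h i)) / real m"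
  using assms(4)
proof (induction h)
  case (Cons a h)
  obtain j d where a: "a = (j, d)" by fastforce
  have "(case d of None \<Rightarrow> 0 | Some k \<Rightarrow> profit (sign_instance n m \<delta>) i j k)
      \<le> (1 + \<delta> * real_of_int (signs n j i)) / real m"
    using profit_sign_instance_nonneg[OF assms(1,2) _ assms(3), of j m] Cons.prems a
    by (auto split: option.split)
  moreover have "total (profit (sign_instance n m \<delta>) i) h
      \<le> (real (length h) + \<delta> * real_of_int (sign_sum n h i)) / real m"
    using Cons by (auto simp del: sign_instance_simps(6))
  ultimately show ?case
    by (simp add: a total_def sign_sum_def add_divide_distrib algebra_simps
        del: sign_instance_simps(6))
qed (simp add: total_def sign_sum_def)

lemma approx_factor_sign_instance_le:
  fixes s :: real
  assumes nm: "n > 0" "m > 0" and \<delta>: "0 \<le> \<delta>" "\<delta> \<le> 1"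
    and A: "online_algorithm (sign_instance n m \<delta>) A"
  shows "approx_factor (sign_instance n m \<delta>) A
           \<le> 1 - \<delta> * (s / real m) * (1 - (1 - lower_tail m s) ^ (n - 1))"
proof -
  let ?I = "sign_instance n m \<delta>"
  let ?R = "run ?I A m"
  let ?M = "\<lambda>y :: nat \<Rightarrow> int. MIN i\<in>{..<n}. real_of_int (y i)"
  have fin: "finite (set_pmf ?R)"
    using finite_set_pmf_run[OF valid_sign_instance[OF \<delta>] A] by simp
  have obj: "objective ?I h \<le> 1 + \<delta> / real m * ?M (sign_sum n h)" if h: "h \<in> set_pmf ?R" for h
  proof -
    have "?M (sign_sum n h) \<in> (\<lambda>i. real_of_int (sign_sum n h i)) ` {..<n}"
      using nm by (intro Min_in) auto
    then obtain i where i: "i < n" "?M (sign_sum n h) = real_of_int (sign_sum n h i)"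
      by auto
    have "objective ?I h \<le> total (profit ?I i) h"
      unfolding objective_def using i(1) by (intro Min_le) auto
    also have "\<dots> \<le> (real (length h) + \<delta> * real_of_int (sign_sum n h i)) / real m"
      using set_pmf_run[OF h] i(1) by (intro total_profit_sign_instance_le \<delta>) (auto simp: set_pmf_type_pmf)
    also have "\<dots> = 1 + \<delta> / real m * ?M (sign_sum n h)"
      using set_pmf_run[OF h] nm by (simp add: i(2) add_divide_distrib)
    finally show ?thesis .
  qed
  have "approx_factor ?I A = measure_pmf.expectation ?R (objective ?I)"
    by (simp add: approx_factor_def W_E_sign_instance nm \<delta>)
  also have "\<dots> \<le> measure_pmf.expectation ?R (\<lambda>h. 1 + \<delta> / real m * ?M (sign_sum n h))"
    by (intro integral_mono_AE integrable_measure_pmf_finite fin AE_pmfI obj)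
  also have "\<dots> = 1 + \<delta> / real m * measure_pmf.expectation ?R (\<lambda>h. ?M (sign_sum n h))"
    by (simp add: integrable_measure_pmf_finite fin)
  also have "measure_pmf.expectation ?R (\<lambda>h. ?M (sign_sum n h)) =
      measure_pmf.expectation (map_pmf (sign_sum n) ?R) ?M"
    by simp
  also have "\<dots> = measure_pmf.expectation (Pi_pmf {..<n} 0 (\<lambda>_. walk m)) ?M"
    by (simp only: map_sign_sum_run)
  also have "1 + \<delta> / real m * \<dots> \<le>
      1 + \<delta> / real m * (- s * (1 - (1 - lower_tail m s) ^ (n - 1)))"
    using nm \<delta> by (intro add_left_mono mult_left_mono expectation_Min_walks_le) auto
  finally show ?thesis by (simp add: algebra_simps)
qed

section \<open>Choice of the parameters\<close>

text \<open>
  The number of requests has to be an integer; the amplitude \<open>\<delta>\<close> then compensates for the rounding,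
  so that \<open>(1 + \<delta>) / m\<close> is exactly \<open>\<gamma>\<close>.
\<close>

definition hard_instance :: "nat \<Rightarrow> real \<Rightarrow> allocation_instance" where
  "hard_instance n \<epsilon> =
     (let \<gamma> = \<epsilon>\<^sup>2 / ln (real n); m = nat \<lfloor>2 / \<gamma>\<rfloor> in sign_instance n m (real m * \<gamma> - 1))"

lemma nat_floor_two_over:
  fixes \<gamma> :: real
  assumes "0 < \<gamma>" "\<gamma> < 2" and m: "m = nat \<lfloor>2 / \<gamma>\<rfloor>"
  shows "m > 0" "real m * \<gamma> \<le> 2" "1 \<le> real m * \<gamma>" "2 - \<gamma> < real m * \<gamma>"
proof -
  have "1 < 2 / \<gamma>" using assms by simp
  then have f: "\<lfloor>2 / \<gamma>\<rfloor> \<ge> 1" by simp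
  then show m0: "m > 0" using m by simp
  have "real m = of_int \<lfloor>2 / \<gamma>\<rfloor>" unfolding m using f by (intro of_nat_nat) linarith
  then have u: "real m \<le> 2 / \<gamma>" and l: "2 / \<gamma> < real m + 1"
    by linarith+
  show "real m * \<gamma> \<le> 2" using u assms(1) by (simp add: pos_le_divide_eq)
  show l': "2 - \<gamma> < real m * \<gamma>" using l assms(1) by (simp add: pos_divide_less_eq algebra_simps)
  \<comment> \<open>The larger of \<gamma> and \<open>2 - \<gamma>\<close> is at least 1.\<close>
  have "\<gamma> \<le> real m * \<gamma>" using m0 assms by simp
  with l' show "1 \<le> real m * \<gamma>" by linarith
qed

lemma ln_ge_two_thirds:
  assumes "n \<ge> 2"
  shows "ln (real n) \<ge> 2 / 3"
proof -
  have "ln 2 \<le> ln (real n)" using assms by (intro ln_mono) auto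
  with ln2_ge_two_thirds show ?thesis by linarith
qed

lemma gamma_less_2:
  fixes \<epsilon> :: real
  assumes "n \<ge> 2" "0 < \<epsilon>" "\<epsilon> < 1"
  shows "0 < \<epsilon>\<^sup>2 / ln (real n)" "\<epsilon>\<^sup>2 / ln (real n) < 2"
proof -
  have "\<epsilon>\<^sup>2 < 1" using assms by (simp add: power_less_one_iff)
  with ln_ge_two_thirds[OF assms(1)] assms(2)
  show "0 < \<epsilon>\<^sup>2 / ln (real n)" "\<epsilon>\<^sup>2 / ln (real n) < 2"
    by (auto simp: field_simps)
qed

lemma hard_instance_properties:
  assumes "n \<ge> 2" "0 < \<epsilon>" "\<epsilon> < 1"
  shows "valid_instance (hard_instance n \<epsilon>)" "num_resources (hard_instance n \<epsilon>) = n"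
    "W_E (hard_instance n \<epsilon>) = 1" "gamma_param (hard_instance n \<epsilon>) = \<epsilon>\<^sup>2 / ln (real n)"
proof -
  define \<gamma> where "\<gamma> = \<epsilon>\<^sup>2 / ln (real n)"
  define m where "m = nat \<lfloor>2 / \<gamma>\<rfloor>"
  have I: "hard_instance n \<epsilon> = sign_instance n m (real m * \<gamma> - 1)"
    by (simp add: hard_instance_def \<gamma>_def m_def Let_def)
  note m = nat_floor_two_over[OF gamma_less_2[OF assms, folded \<gamma>_def] m_def]
  have d: "0 \<le> real m * \<gamma> - 1" "real m * \<gamma> - 1 \<le> 1" using m by auto
  have n: "n > 0" using assms by simp
  show "valid_instance (hard_instance n \<epsilon>)" "num_resources (hard_instance n \<epsilon>) = n"
    "W_E (hard_instance n \<epsilon>) = 1"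
    unfolding I using valid_sign_instance[OF d] W_E_sign_instance[OF n m(1) d] by auto
  show "gamma_param (hard_instance n \<epsilon>) = \<epsilon>\<^sup>2 / ln (real n)"
    unfolding I gamma_param_sign_instance[OF n m(1) d] using m(1) by (simp add: \<gamma>_def)
qed

lemma ln_10_bounds: "1 \<le> ln (10 :: real)" "ln (10 :: real) \<le> 3"
proof -
  show "1 \<le> ln (10 :: real)"
    using exp_le by (subst ln_ge_iff) auto
  have "ln (10 :: real) \<le> ln (2 ^ 4)" by (intro ln_mono) auto
  also have "\<dots> = 4 * ln 2" by (subst ln_realpow) auto
  also have "\<dots> \<le> 3" using ln2_le_25_over_36 by simp
  finally show "ln (10 :: real) \<le> 3" .
qed

text \<open>Combine \<open>1 - p \<le> exp (- p)\<close> with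
  \<open>exp (- x) \<le> 1 / (1 + x)\<close>.\<close>

lemma one_minus_power_ge:
  fixes p :: real
  assumes "0 \<le> p" "p \<le> 1" "x \<le> real k * p" "0 \<le> x"
  shows "1 - (1 - p) ^ k \<ge> x / (1 + x)"
proof -
  have "(1 - p) ^ k \<le> exp (- p) ^ k"
    using assms exp_ge_add_one_self[of "- p"] by (intro power_mono) auto
  also have "\<dots> = exp (- (real k * p))"
    by (simp add: exp_of_nat_mult[symmetric])
  also have "\<dots> \<le> exp (- x)" using assms by simp
  also have "\<dots> \<le> 1 / (1 + x)"
    using exp_ge_add_one_self[of x] assms by (simp add: exp_minus field_simps)
  finally show ?thesis using assms by (simp add: field_simps)
qed

text \<open>With \<open>L\<close> of order \<open>ln n\<close> blocks of length \<open>b\<close>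
  about \<open>m / L\<close>, a walk falls by \<open>s\<close> of order \<open>sqrt (L * m)\<close>,
  hence of order \<open>\<epsilon> * m\<close>, with probability at least
  \<open>1 / (20 * n)\<close>. The constant 574 is the product of 2, 7 and 41, from the bounds on
  \<delta>, on \<open>s / m\<close> and on the probability that some walk falls.\<close>

lemma approx_factor_hard_instance_le:
  assumes n: "n \<ge> 2" and \<epsilon>: "0 < \<epsilon>" "\<epsilon> \<le> 1 / 2"
    and A: "online_algorithm (hard_instance n \<epsilon>) A"
  shows "approx_factor (hard_instance n \<epsilon>) A \<le> 1 - \<epsilon> / 574"
proof -
  have \<epsilon>1: "\<epsilon> < 1" using \<epsilon> by simp
  define \<gamma> where "\<gamma> = \<epsilon>\<^sup>2 / ln (real n)"
  define m where "m = nat \<lfloor>2 / \<gamma>\<rfloor>"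
  define \<delta> where "\<delta> = real m * \<gamma> - 1"
  have I: "hard_instance n \<epsilon> = sign_instance n m \<delta>"
    by (simp add: hard_instance_def \<gamma>_def m_def \<delta>_def Let_def)
  note m = nat_floor_two_over[OF gamma_less_2[OF n \<epsilon>(1) \<epsilon>1, folded \<gamma>_def] m_def]
  have ln: "ln (real n) \<ge> 2 / 3" by (rule ln_ge_two_thirds[OF n])
  have \<epsilon>2: "\<epsilon>\<^sup>2 \<le> 1 / 4"
    using power_mono[of \<epsilon> "1 / 2" 2] \<epsilon> by (simp add: power_divide)
  have "\<gamma> \<le> 1 / 2"
    unfolding \<gamma>_def using ln \<epsilon>2 by (simp add: divide_le_eq)
  then have \<delta>: "1 / 2 \<le> \<delta>" "\<delta> \<le> 1" using m by (auto simp: \<delta>_def)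

  \<comment> \<open>Blocks succeed with probability 1/10, so \<open>L\<close> is chosen with
    \<open>10 ^ L\<close> between \<open>n\<close> and \<open>10 * n\<close>.\<close>
  obtain l where l: "10 ^ l \<le> n" "n < 10 ^ (l + 1)"
    using ex_power_ivl1[of 10 n] n by auto
  then have lr: "10 ^ l \<le> real n" "real n \<le> 10 ^ (l + 1)"
    by (metis of_nat_le_iff of_nat_power of_nat_numeral less_imp_le)+
  define L where "L = Suc l"
  have "real l \<le> real l * ln 10"
    using mult_left_mono[OF ln_10_bounds(1), of "real l"] by simp
  also have "\<dots> = ln (10 ^ l)" by (simp add: ln_realpow)
  also have "\<dots> \<le> ln (real n)"
    using lr(1) n by (intro ln_mono) auto
  finally have Lu: "real L \<le> 4 * ln (real n)" using ln by (simp add: L_def)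
  have "ln (real n) \<le> ln (10 ^ L)"
    using lr(2) n by (intro ln_mono) (auto simp: L_def)
  also have "\<dots> = real L * ln 10" by (simp add: ln_realpow)
  also have "\<dots> \<le> real L * 3" using ln_10_bounds by (intro mult_left_mono) auto
  finally have Ll: "ln (real n) \<le> 3 * real L" by simp

  have mu: "\<epsilon>\<^sup>2 * real m \<le> 2 * ln (real n)" and ml: "ln (real n) \<le> \<epsilon>\<^sup>2 * real m"
    using m(2,3) ln by (auto simp: \<gamma>_def field_simps)
  have "4 * ln (real n) \<le> real m"
    using ml mult_right_mono[OF \<epsilon>2, of "real m"] by simp
  with Lu have "L \<le> m" by linarith
  define b where "b = m div L"
  have b0: "b > 0" using \<open>L \<le> m\<close> by (simp add: b_def L_def div_greater_zero_iff)
  have m_eq: "m = L * b + m mod L" by (simp add: b_def)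
  \<comment> \<open>The leftover is shorter than one round of blocks, so the blocks cover at least
    half of the walk.\<close>
  have "m mod L < L" by (simp add: L_def)
  also have "L \<le> L * b" using b0 by simp
  finally have "m \<le> 2 * (L * b)" using m_eq by linarith
  then have bl: "real m \<le> 2 * real L * real b"
    by (metis of_nat_le_iff of_nat_mult of_nat_numeral mult.assoc)

  define s where "s = real L * (sqrt b / 2)"
  have s0: "s \<ge> 0" by (simp add: s_def)
  have "(\<epsilon> * real m / 7)\<^sup>2 = (\<epsilon>\<^sup>2 * real m) * real m / 49"
    by (simp add: power2_eq_square)
  also have "\<dots> \<le> (6 * real L) * (2 * real L * real b) / 49"
    using mu Ll bl by (intro divide_right_mono mult_mono[of _ "6 * real L"]) auto
  \<comment> \<open>The divisor 7 is the least integer that works here: 12/49 is below 1/4.\<close>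
  also have "\<dots> \<le> (real L)\<^sup>2 * real b / 4"
    by (simp add: power2_eq_square)
  also have "\<dots> = s\<^sup>2" by (simp add: s_def power_mult_distrib power_divide)
  finally have "\<epsilon> * real m / 7 \<le> s" by (rule power2_le_imp_le) (rule s0)
  then have sm: "\<epsilon> / 7 \<le> s / real m" using m(1) by (simp add: field_simps)

  have "(1 / 10) ^ L / 2 \<le> lower_tail m s"
    using lower_tail_blocks[OF b0, of L "m mod L"] m_eq by (simp add: s_def)
  moreover have "1 / (20 * real n) \<le> (1 / 10) ^ L / 2"
    using lr(1) n by (simp add: L_def power_one_over field_simps)
  ultimately have p: "1 / (20 * real n) \<le> lower_tail m s" by simp
  \<comment> \<open>Walk 0 is set aside, and \<open>n - 1\<close> is at least half of
    \<open>n\<close>. Taking \<open>x = 1 / 40\<close> in \<open>x / (1 + x)\<close> then gives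
    1/41.\<close>
  have "1 / 40 \<le> real (n - 1) * (1 / (20 * real n))"
    using n by (simp add: field_simps of_nat_diff)
  also have "\<dots> \<le> real (n - 1) * lower_tail m s"
    by (rule mult_left_mono[OF p]) simp
  finally have np: "1 / 40 \<le> real (n - 1) * lower_tail m s" .
  have "(1 / 40) / (1 + 1 / 40) \<le> 1 - (1 - lower_tail m s) ^ (n - 1)"
    by (rule one_minus_power_ge[OF _ _ np]) (auto simp: lower_tail_def)
  then have q: "1 / 41 \<le> 1 - (1 - lower_tail m s) ^ (n - 1)" by simp

  have "\<epsilon> / 574 = 1 / 2 * (\<epsilon> / 7) * (1 / 41)" by simp
  also have "\<dots> \<le> \<delta> * (s / real m) * (1 - (1 - lower_tail m s) ^ (n - 1))"
    using \<delta> sm q \<epsilon> s0 by (intro mult_mono) auto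
  finally show ?thesis
    using approx_factor_sign_instance_le[of n m \<delta> A s] A n m(1) \<delta> unfolding I by simp
qed

theorem theorem2:
  shows "\<exists>I :: nat \<Rightarrow> real \<Rightarrow> allocation_instance.
    (\<forall>n \<epsilon>. n \<ge> 2 \<and> 0 < \<epsilon> \<and> \<epsilon> < 1 \<longrightarrow>
       valid_instance (I n \<epsilon>) \<and> num_resources (I n \<epsilon>) = n \<and> W_E (I n \<epsilon>) > 0 \<and>
       gamma_param (I n \<epsilon>) = \<epsilon>\<^sup>2 / ln (real n)) \<and>
    (\<forall>f :: real \<Rightarrow> real. f \<in> o[at_right 0](\<lambda>\<epsilon>. \<epsilon>) \<longrightarrow>
       (\<forall>\<^sub>F \<epsilon> in at_right 0. \<forall>n\<ge>2.
          \<not> (\<exists>A. online_algorithm (I n \<epsilon>) A \<and> approx_factor (I n \<epsilon>) A \<ge> 1 - f \<epsilon>)))"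
proof (intro exI[of _ hard_instance] conjI allI impI)
  fix f :: "real \<Rightarrow> real" assume f: "f \<in> o[at_right 0](\<lambda>\<epsilon>. \<epsilon>)"
  \<comment> \<open>Any constant below 1/574 would do. The loss does not depend on \<open>n\<close>,
    so one neighbourhood of 0 serves all \<open>n\<close>.\<close>
  have "\<forall>\<^sub>F \<epsilon> in at_right 0. norm (f \<epsilon>) \<le> 1 / 1000 * norm \<epsilon>"
    by (rule landau_o.smallD[OF f]) simp
  moreover have "\<forall>\<^sub>F \<epsilon> in at_right 0. \<epsilon> \<in> {0<..<1 / 2 :: real}"
    by (rule eventually_at_right_real) simp
  ultimately show "\<forall>\<^sub>F \<epsilon> in at_right 0. \<forall>n\<ge>2.
      \<not> (\<exists>A. online_algorithm (hard_instance n \<epsilon>) A \<and> approx_factor (hard_instance n \<epsilon>) A \<ge> 1 - f \<epsilon>)"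
  proof eventually_elim
    case (elim \<epsilon>)
    show ?case
    proof (intro allI impI notI, elim exE conjE)
      fix n A
      assume "2 \<le> n" "online_algorithm (hard_instance n \<epsilon>) A"
        and ge: "1 - f \<epsilon> \<le> approx_factor (hard_instance n \<epsilon>) A"
      then have "approx_factor (hard_instance n \<epsilon>) A \<le> 1 - \<epsilon> / 574"
        using elim by (intro approx_factor_hard_instance_le) auto
      with ge elim show False by auto
    qed
  qed
qed (auto simp: hard_instance_properties)

end
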